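(* Let $A$ and $B$ be AL-monoids and let $\alpha : A \to B$ be a homomorphism of AL-monoids. Then $\ker(\alpha)$ is a prime ideal of $A$ if and only if $\operatorname{Im}(\alpha)$ is a chain AL-monoid (i.e. an AL-monoid whose lattice order is total).
   Context: An AL-monoid (autometrized lattice ordered monoid) is an algebra $(A,+,\vee,\wedge,\ast,0)$ of arity $(2,2,2,2,0)$ such that: (1) $(A,+,\vee,\wedge,0)$ is a commutative lattice ordered monoid, i.e. $(A,+,0)$ is a commutative monoid, $(A,\vee,\wedge)$ is a lattice with induced order $\leq$, and $+$ distributes over $\vee$ and over $\wedge$; (2) $a\ast(a\wedge b)+b=a\vee b$ for all $a,b\in A$; (3) for each $a\in A$ the maps $x\mapsto a+x$, $x\mapsto a\vee x$, $x\mapsto a\wedge x$, $x\mapsto a\ast x$ are contractions with respect to $\ast$, where $f:A\to A$ is a contraction if $f(x)\ast f(y)\leq x\ast y$ for all $x,y\in A$; (4) $[a\ast(a\vee b)]\wedge[b\ast(a\vee b)]=0$ for all $a,b\in A$. An ideal of $A$ is a nonempty subset $I\subseteq A$ such that $a,b\in I$ implies $a+b\in I$, and $a\in I$, $b\in A$, $b\ast 0\leq a\ast 0$ imply $b\in I$. An ideal $P$ is prime if for all ideals $I,J$ of $A$, $I\cap J\subseteq P$ implies $I\subseteq P$ or $J\subseteq P$ (here $P=A$ is allowed). A homomorphism $f:A\to B$ of AL-monoids is a map preserving $+,\ast,\vee,\wedge$ and $0$. $\ker(\alpha)=\{a\in A: \alpha(a)=0\}$ and $\operatorname{Im}(\alpha)=\{\alpha(a):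 a\in A\}$. *)

theory Defs
  imports "HOL-Algebra.Group"
begin

record 'a al_algebra = "'a partial_object" +
  al_add :: "['a, 'a] \<Rightarrow> 'a" (infixl "\<oplus>\<index>" 65)
  al_sup :: "['a, 'a] \<Rightarrow> 'a" (infixl "\<curlyvee>\<index>" 60)
  al_inf :: "['a, 'a] \<Rightarrow> 'a" (infixl "\<curlywedge>\<index>" 62)
  al_dist :: "['a, 'a] \<Rightarrow> 'a" (infixl "\<star>\<index>" 70)
  al_zero :: 'a ("\<zero>\<index>")

definition al_le :: "('a, 'm) al_algebra_scheme \<Rightarrow> 'a \<Rightarrow> 'a \<Rightarrow> bool" (infix "\<preceq>\<index>" 50)
  where "a \<preceq>\<^bsub>A\<^esub> b \<longleftrightarrow> a \<curlywedge>\<^bsub>A\<^esub> b = a"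

definition al_contraction :: "('a, 'm) al_algebra_scheme \<Rightarrow> ('a \<Rightarrow> 'a) \<Rightarrow> bool"
  where "al_contraction A f \<longleftrightarrow>
    f \<in> carrier A \<rightarrow> carrier A \<and>
    (\<forall>x\<in>carrier A. \<forall>y\<in>carrier A. f x \<star>\<^bsub>A\<^esub> f y \<preceq>\<^bsub>A\<^esub> x \<star>\<^bsub>A\<^esub> y)"

locale al_monoid =
  fixes A :: "('a, 'm) al_algebra_scheme" (structure)
  assumes add_comm_monoid:
      "comm_monoid \<lparr>carrier = carrier A, mult = al_add A, one = \<zero>\<rparr>"
    and sup_closed: "\<lbrakk>a \<in> carrier A; b \<in> carrier A\<rbrakk> \<Longrightarrow> a \<curlyvee> b \<in> carrier A"
    and inf_closed: "\<lbrakk>a \<in> carrier A; b \<in> carrier A\<rbrakk> \<Longrightarrow> a \<curlywedge> b \<in> carrier A"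
    and dist_closed: "\<lbrakk>a \<in> carrier A; b \<in> carrier A\<rbrakk> \<Longrightarrow> a \<star> b \<in> carrier A"
    and sup_comm: "\<lbrakk>a \<in> carrier A; b \<in> carrier A\<rbrakk> \<Longrightarrow> a \<curlyvee> b = b \<curlyvee> a"
    and inf_comm: "\<lbrakk>a \<in> carrier A; b \<in> carrier A\<rbrakk> \<Longrightarrow> a \<curlywedge> b = b \<curlywedge> a"
    and sup_assoc: "\<lbrakk>a \<in> carrier A; b \<in> carrier A; c \<in> carrier A\<rbrakk>
      \<Longrightarrow> (a \<curlyvee> b) \<curlyvee> c = a \<curlyvee> (b \<curlyvee> c)"
    and inf_assoc: "\<lbrakk>a \<in> carrier A; b \<in> carrier A; c \<in> carrier A\<rbrakk>
      \<Longrightarrow> (a \<curlywedge> b) \<curlywedge> c = a \<curlywedge> (b \<curlywedge> c)"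
    and sup_inf_absorb: "\<lbrakk>a \<in> carrier A; b \<in> carrier A\<rbrakk> \<Longrightarrow> a \<curlyvee> (a \<curlywedge> b) = a"
    and inf_sup_absorb: "\<lbrakk>a \<in> carrier A; b \<in> carrier A\<rbrakk> \<Longrightarrow> a \<curlywedge> (a \<curlyvee> b) = a"
    and add_sup_distrib: "\<lbrakk>a \<in> carrier A; b \<in> carrier A; c \<in> carrier A\<rbrakk>
      \<Longrightarrow> a \<oplus> (b \<curlyvee> c) = (a \<oplus> b) \<curlyvee> (a \<oplus> c)"
    and add_inf_distrib: "\<lbrakk>a \<in> carrier A; b \<in> carrier A; c \<in> carrier A\<rbrakk>
      \<Longrightarrow> a \<oplus> (b \<curlywedge> c) = (a \<oplus> b) \<curlywedge> (a \<oplus> c)"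
    and dist_inf_add: "\<lbrakk>a \<in> carrier A; b \<in> carrier A\<rbrakk>
      \<Longrightarrow> (a \<star> (a \<curlywedge> b)) \<oplus> b = a \<curlyvee> b"
    and add_contraction: "a \<in> carrier A \<Longrightarrow> al_contraction A (\<lambda>x. a \<oplus> x)"
    and sup_contraction: "a \<in> carrier A \<Longrightarrow> al_contraction A (\<lambda>x. a \<curlyvee> x)"
    and inf_contraction: "a \<in> carrier A \<Longrightarrow> al_contraction A (\<lambda>x. a \<curlywedge> x)"
    and dist_contraction: "a \<in> carrier A \<Longrightarrow> al_contraction A (\<lambda>x. a \<star> x)"
    and dist_sup_disjoint: "\<lbrakk>a \<in> carrier A; b \<in> carrier A\<rbrakk>
      \<Longrightarrow> (a \<star> (a \<curlyvee> b)) \<curlywedge> (b \<star> (a \<curlyvee> b)) = \<zero>"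

locale chain_al_monoid = al_monoid +
  assumes total: "\<lbrakk>a \<in> carrier A; b \<in> carrier A\<rbrakk> \<Longrightarrow> a \<preceq> b \<or> b \<preceq> a"

definition al_ideal :: "('a, 'm) al_algebra_scheme \<Rightarrow> 'a set \<Rightarrow> bool"
  where "al_ideal A I \<longleftrightarrow>
    I \<noteq> {} \<and> I \<subseteq> carrier A \<and>
    (\<forall>a\<in>I. \<forall>b\<in>I. a \<oplus>\<^bsub>A\<^esub> b \<in> I) \<and>
    (\<forall>a\<in>I. \<forall>b\<in>carrier A. b \<star>\<^bsub>A\<^esub> \<zero>\<^bsub>A\<^esub> \<preceq>\<^bsub>A\<^esub> a \<star>\<^bsub>A\<^esub> \<zero>\<^bsub>A\<^esub> \<longrightarrow> b \<in> I)"

text \<open>A prime ideal need not be proper: the whole carrier is prime.\<close>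

definition al_prime_ideal :: "('a, 'm) al_algebra_scheme \<Rightarrow> 'a set \<Rightarrow> bool"
  where "al_prime_ideal A P \<longleftrightarrow>
    al_ideal A P \<and>
    (\<forall>I J. al_ideal A I \<longrightarrow> al_ideal A J \<longrightarrow> I \<inter> J \<subseteq> P \<longrightarrow> I \<subseteq> P \<or> J \<subseteq> P)"

definition al_hom ::
    "('a, 'm) al_algebra_scheme \<Rightarrow> ('b, 'n) al_algebra_scheme \<Rightarrow> ('a \<Rightarrow> 'b) set"
  where "al_hom A B =
    {f \<in> carrier A \<rightarrow> carrier B.
      (\<forall>x\<in>carrier A. \<forall>y\<in>carrier A.
        f (x \<oplus>\<^bsub>A\<^esub> y) = f x \<oplus>\<^bsub>B\<^esub> f y \<and>
        f (x \<star>\<^bsub>A\<^esub> y) = f x \<star>\<^bsub>B\<^esub> f y \<and>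
        f (x \<curlyvee>\<^bsub>A\<^esub> y) = f x \<curlyvee>\<^bsub>B\<^esub> f y \<and>
        f (x \<curlywedge>\<^bsub>A\<^esub> y) = f x \<curlywedge>\<^bsub>B\<^esub> f y) \<and>
      f \<zero>\<^bsub>A\<^esub> = \<zero>\<^bsub>B\<^esub>}"

definition al_kernel ::
    "('a, 'm) al_algebra_scheme \<Rightarrow> ('b, 'n) al_algebra_scheme \<Rightarrow> ('a \<Rightarrow> 'b) \<Rightarrow> 'a set"
  where "al_kernel A B f = {a \<in> carrier A. f a = \<zero>\<^bsub>B\<^esub>}"

text \<open>The image carries the operations of the codomain.\<close>

definition al_image ::
    "('a, 'm) al_algebra_scheme \<Rightarrow> ('b, 'n) al_algebra_scheme \<Rightarrow> ('a \<Rightarrow> 'b)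
      \<Rightarrow> ('b, 'n) al_algebra_scheme"
  where "al_image A B f = B\<lparr>carrier := f ` carrier A\<rparr>"

end

theory Submission
  imports Defs
begin

text \<open>
  The axioms already force the distance to be a metric with values in the positive cone. If the
  kernel is prime, the ideals \<open>I = {y}\<^sup>\<bottom>\<close> and \<open>J = I\<^sup>\<bottom>\<close> with \<open>y = b \<star> (a \<curlyvee> b)\<close> meet only in
  zero, so one of them lies in the kernel; as \<open>a \<star> (a \<curlyvee> b)\<close> is in \<open>I\<close> and \<open>y\<close> is in \<open>J\<close>, the images
  of \<open>a\<close> and \<open>b\<close> are comparable. Using polars in place of principal ideals avoids multiples of
  elements. Conversely, if the image is a chain and \<open>a \<in> I\<close>, \<open>b \<in> J\<close> lie outside the kernel, then
  \<open>(a \<star> \<zero>) \<curlywedge> (b \<star> \<zero>)\<close> is in \<open>I \<inter> J\<close> and is mapped to the smaller of two nonzero elements.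
\<close>

section \<open>Monoid and lattice rules relative to the carrier\<close>

context al_monoid
begin

lemma zero_closed [simp]: "\<zero> \<in> carrier A"
  using comm_monoid.axioms(1)[OF add_comm_monoid] monoid.one_closed by fastforce

lemma add_closed [simp]: "\<lbrakk>a \<in> carrier A; b \<in> carrier A\<rbrakk> \<Longrightarrow> a \<oplus> b \<in> carrier A"
  using monoid.m_closed[OF comm_monoid.axioms(1)[OF add_comm_monoid], of a b] by simp

lemma add_comm: "\<lbrakk>a \<in> carrier A; b \<in> carrier A\<rbrakk> \<Longrightarrow> a \<oplus> b = b \<oplus> a"
  using comm_monoid.m_comm[OF add_comm_monoid, of a b] by simp

lemma add_assoc:
  "\<lbrakk>a \<in> carrier A; b \<in> carrier A; c \<in> carrier A\<rbrakk> \<Longrightarrow> (a \<oplus> b) \<oplus> c = a \<oplus> (b \<oplus> c)"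
  using monoid.m_assoc[OF comm_monoid.axioms(1)[OF add_comm_monoid], of a b c] by simp

lemma add_zero_right [simp]: "a \<in> carrier A \<Longrightarrow> a \<oplus> \<zero> = a"
  using monoid.r_one[OF comm_monoid.axioms(1)[OF add_comm_monoid], of a] by simp

lemma add_zero_left [simp]: "a \<in> carrier A \<Longrightarrow> \<zero> \<oplus> a = a"
  using monoid.l_one[OF comm_monoid.axioms(1)[OF add_comm_monoid], of a] by simp

declare sup_closed [simp] inf_closed [simp] dist_closed [simp]

lemma inf_idem [simp]: "a \<in> carrier A \<Longrightarrow> a \<curlywedge> a = a"
  by (metis inf_closed inf_sup_absorb sup_inf_absorb)

lemma sup_idem [simp]: "a \<in> carrier A \<Longrightarrow> a \<curlyvee> a = a"
  by (metis inf_idem sup_inf_absorb)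

lemma le_refl: "a \<in> carrier A \<Longrightarrow> a \<preceq> a"
  by (simp add: al_le_def)

lemma le_antisym: "\<lbrakk>a \<in> carrier A; b \<in> carrier A; a \<preceq> b; b \<preceq> a\<rbrakk> \<Longrightarrow> a = b"
  by (metis al_le_def inf_comm)

lemma le_trans [trans]:
  "\<lbrakk>a \<preceq> b; b \<preceq> c; a \<in> carrier A; b \<in> carrier A; c \<in> carrier A\<rbrakk> \<Longrightarrow> a \<preceq> c"
  by (metis al_le_def inf_assoc)

lemma le_iff_sup: "\<lbrakk>a \<in> carrier A; b \<in> carrier A\<rbrakk> \<Longrightarrow> a \<preceq> b \<longleftrightarrow> a \<curlyvee> b = b"
  by (metis al_le_def inf_comm inf_sup_absorb sup_comm sup_inf_absorb)

lemma inf_le1: "\<lbrakk>a \<in> carrier A; b \<in> carrier A\<rbrakk> \<Longrightarrow> a \<curlywedge> b \<preceq> a"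
  by (metis al_le_def inf_assoc inf_comm inf_idem inf_closed)

lemma inf_le2: "\<lbrakk>a \<in> carrier A; b \<in> carrier A\<rbrakk> \<Longrightarrow> a \<curlywedge> b \<preceq> b"
  by (metis inf_comm inf_le1)

lemma le_infI:
  "\<lbrakk>c \<preceq> a; c \<preceq> b; a \<in> carrier A; b \<in> carrier A; c \<in> carrier A\<rbrakk> \<Longrightarrow> c \<preceq> a \<curlywedge> b"
  by (metis al_le_def inf_assoc)

lemma sup_ge1: "\<lbrakk>a \<in> carrier A; b \<in> carrier A\<rbrakk> \<Longrightarrow> a \<preceq> a \<curlyvee> b"
  by (simp add: al_le_def inf_sup_absorb)

lemma add_left_mono:
  "\<lbrakk>a \<preceq> b; a \<in> carrier A; b \<in> carrier A; c \<in> carrier A\<rbrakk> \<Longrightarrow> c \<oplus> a \<preceq> c \<oplus> b"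
  by (metis add_inf_distrib al_le_def)

lemma add_right_mono:
  "\<lbrakk>a \<preceq> b; a \<in> carrier A; b \<in> carrier A; c \<in> carrier A\<rbrakk> \<Longrightarrow> a \<oplus> c \<preceq> b \<oplus> c"
  by (metis add_left_mono add_comm)

lemma inf_mono:
  assumes "a \<preceq> c" "b \<preceq> d"
    and "a \<in> carrier A" "b \<in> carrier A" "c \<in> carrier A" "d \<in> carrier A"
  shows "a \<curlywedge> b \<preceq> c \<curlywedge> d"
  using assms by (meson inf_closed inf_le1 inf_le2 le_infI le_trans)

section \<open>The distance as a metric with nonnegative values\<close>

lemma dist_add_le:
  "\<lbrakk>a \<in> carrier A; x \<in> carrier A; y \<in> carrier A\<rbrakk> \<Longrightarrow> (a \<oplus> x) \<star> (a \<oplus> y) \<preceq> x \<star> y"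
  using add_contraction[of a] by (simp add: al_contraction_def)

lemma dist_sup_le:
  "\<lbrakk>a \<in> carrier A; x \<in> carrier A; y \<in> carrier A\<rbrakk> \<Longrightarrow> (a \<curlyvee> x) \<star> (a \<curlyvee> y) \<preceq> x \<star> y"
  using sup_contraction[of a] by (simp add: al_contraction_def)

lemma dist_inf_le:
  "\<lbrakk>a \<in> carrier A; x \<in> carrier A; y \<in> carrier A\<rbrakk> \<Longrightarrow> (a \<curlywedge> x) \<star> (a \<curlywedge> y) \<preceq> x \<star> y"
  using inf_contraction[of a] by (simp add: al_contraction_def)

lemma dist_dist_le:
  "\<lbrakk>a \<in> carrier A; x \<in> carrier A; y \<in> carrier A\<rbrakk> \<Longrightarrow> (a \<star> x) \<star> (a \<star> y) \<preceq> x \<star> y"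
  using dist_contraction[of a] by (simp add: al_contraction_def)

lemma dist_self [simp]: "a \<in> carrier A \<Longrightarrow> a \<star> a = \<zero>"
  using dist_sup_disjoint[of a a] by simp

text \<open>In \<open>dist_sup_disjoint\<close> for \<open>a\<close> and
  \<open>a \<curlyvee> b\<close> the second distance is \<open>\<zero>\<close>, so
  \<open>\<zero>\<close> lies below \<open>a \<star> (a \<curlyvee> b)\<close>. The contraction
  \<open>a \<curlyvee> _\<close> bounds the latter by \<open>a \<star> b\<close>.\<close>

lemma dist_nonneg:
  assumes a: "a \<in> carrier A" and b: "b \<in> carrier A"
  shows "\<zero> \<preceq> a \<star> b"
proof -
  have "(a \<star> (a \<curlyvee> b)) \<curlywedge> ((a \<curlyvee> b) \<star> (a \<curlyvee> b)) = \<zero>"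
    using dist_sup_disjoint[of a "a \<curlyvee> b"] sup_assoc[of a a b] a b by simp
  hence "\<zero> \<preceq> a \<star> (a \<curlyvee> b)"
    using inf_comm a b by (simp add: al_le_def)
  also have "a \<star> (a \<curlyvee> b) \<preceq> a \<star> b"
    using dist_sup_le[of a a b] a b by simp
  finally show ?thesis using a b by simp
qed

text \<open>Axiom \<open>dist_inf_add\<close> at \<open>b = \<zero>\<close>: the meet is
  \<open>\<zero>\<close> and the join is \<open>a\<close>. Hence taking the norm
  \<open>_ \<star> \<zero>\<close> of a distance changes nothing.\<close>

lemma dist_zero_of_nonneg: "\<lbrakk>a \<in> carrier A; \<zero> \<preceq> a\<rbrakk> \<Longrightarrow> a \<star> \<zero> = a"
  using dist_inf_add[of a \<zero>] inf_comm[of a \<zero>] sup_comm[of a \<zero>] le_iff_sup[of \<zero> a]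
  by (simp add: al_le_def)

text \<open>The contraction \<open>x \<star> _\<close> applied to the pair \<open>y\<close>,
  \<open>x\<close> gives \<open>(x \<star> y) \<star> \<zero> \<preceq> y \<star> x\<close>, whose
  left side is \<open>x \<star> y\<close>.\<close>

lemma dist_comm:
  assumes "a \<in> carrier A" "b \<in> carrier A"
  shows "a \<star> b = b \<star> a"
proof -
  have "x \<star> y \<preceq> y \<star> x" if "x \<in> carrier A" "y \<in> carrier A" for x y
    using dist_dist_le[of x y x] dist_zero_of_nonneg[of "x \<star> y"] dist_nonneg[of x y] that by simp
  with assms show ?thesis by (simp add: le_antisym)
qed

lemma dist_inf_right_le: "\<lbrakk>a \<in> carrier A; b \<in> carrier A\<rbrakk> \<Longrightarrow> a \<star> (a \<curlywedge> b) \<preceq> a \<star> b"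
  using dist_inf_le[of a a b] by simp

text \<open>With the distance zero, axiom \<open>dist_inf_add\<close> for
  \<open>a \<curlyvee> b\<close> and \<open>a\<close> becomes
  \<open>a = (a \<curlyvee> b) \<curlyvee> a\<close>.\<close>

lemma dist_sup_eq_zero_imp_le:
  assumes a: "a \<in> carrier A" and b: "b \<in> carrier A" and eq: "a \<star> (a \<curlyvee> b) = \<zero>"
  shows "b \<preceq> a"
proof -
  have "(a \<curlyvee> b) \<star> ((a \<curlyvee> b) \<curlywedge> a) = \<zero>"
    using eq a b by (simp add: inf_comm[of "a \<curlyvee> b" a] inf_sup_absorb dist_comm)
  hence "a = (a \<curlyvee> b) \<curlyvee> a"
    using dist_inf_add[of "a \<curlyvee> b" a] a b by simp
  also have "\<dots> = a \<curlyvee> b"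
    using a b by (metis sup_assoc sup_comm sup_idem sup_closed)
  finally show ?thesis
    using a b by (simp add: le_iff_sup sup_comm[of b a])
qed

lemma dist_eq_zero_iff:
  assumes a: "a \<in> carrier A" and b: "b \<in> carrier A"
  shows "a \<star> b = \<zero> \<longleftrightarrow> a = b"
proof
  assume eq: "a \<star> b = \<zero>"
  have "y \<preceq> x" if "x \<star> y = \<zero>" "x \<in> carrier A" "y \<in> carrier A" for x y
  proof (rule dist_sup_eq_zero_imp_le)
    \<comment> \<open>The contraction \<open>x \<curlyvee> _\<close> squeezes this distance between
      \<open>\<zero>\<close> and \<open>x \<star> y = \<zero>\<close>.\<close>
    show "x \<star> (x \<curlyvee> y) = \<zero>"
      using dist_sup_le[of x x y] dist_nonneg[of x "x \<curlyvee> y"] that by (simp add: le_antisym)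
  qed (use that in auto)
  with eq a b show "a = b" by (metis dist_comm le_antisym)
qed (use a in simp)

text \<open>Axiom \<open>dist_inf_add\<close> bounds \<open>a\<close> with a meet inside the
  distance; the contraction \<open>a \<curlywedge> _\<close> removes that meet.\<close>

lemma le_dist_add:
  assumes a: "a \<in> carrier A" and b: "b \<in> carrier A"
  shows "a \<preceq> (a \<star> b) \<oplus> b"
proof -
  have "a \<preceq> (a \<star> (a \<curlywedge> b)) \<oplus> b"
    using a b by (simp add: dist_inf_add sup_ge1)
  also have "\<dots> \<preceq> (a \<star> b) \<oplus> b"
    using a b by (simp add: add_right_mono dist_inf_right_le)
  finally show ?thesis using a b by simp
qed

text \<open>The trick is to apply \<open>le_dist_add\<close> to the distances
  \<open>a \<star> c\<close> and \<open>a \<star> b\<close> themselves; the contraction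
  \<open>a \<star> _\<close> then bounds their mutual distance by
  \<open>c \<star> b\<close>.\<close>

lemma dist_triangle:
  assumes a: "a \<in> carrier A" and b: "b \<in> carrier A" and c: "c \<in> carrier A"
  shows "a \<star> c \<preceq> (a \<star> b) \<oplus> (b \<star> c)"
proof -
  have "a \<star> c \<preceq> ((a \<star> c) \<star> (a \<star> b)) \<oplus> (a \<star> b)"
    using a b c by (simp add: le_dist_add)
  also have "\<dots> \<preceq> (c \<star> b) \<oplus> (a \<star> b)"
    using a b c by (simp add: add_right_mono dist_dist_le)
  finally show ?thesis
    using a b c by (simp add: add_comm dist_comm)
qed

section \<open>Norm inequalities and polars\<close>

lemma norm_add_le:
  assumes a: "a \<in> carrier A" and b: "b \<in> carrier A"
  shows "(a \<oplus> b) \<star> \<zero> \<preceq> (a \<star> \<zero>) \<oplus> (b \<star> \<zero>)"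
proof -
  \<comment> \<open>The path to \<open>\<zero>\<close> goes through
    \<open>a = a \<oplus> \<zero>\<close>, so translation by \<open>a\<close> contracts its first
    leg to the norm of \<open>b\<close>.\<close>
  have "(a \<oplus> b) \<star> \<zero> \<preceq> ((a \<oplus> b) \<star> a) \<oplus> (a \<star> \<zero>)"
    using a b by (simp add: dist_triangle)
  also have "\<dots> \<preceq> (b \<star> \<zero>) \<oplus> (a \<star> \<zero>)"
    using a b dist_add_le[of a b \<zero>] by (simp add: add_right_mono)
  finally show ?thesis
    using a b by (simp add: add_comm)
qed

text \<open>Expanding the right-hand side gives \<open>(c \<oplus> c) \<curlywedge> (c \<oplus> b) \<curlywedge> (a \<oplus> c) \<curlywedge> (a \<oplus> b)\<close>.\<close>

lemma inf_add_le:
  assumes a: "a \<in> carrier A" "\<zero> \<preceq> a" and b: "b \<in> carrier A" "\<zero> \<preceq> b"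
    and c: "c \<in> carrier A" "\<zero> \<preceq> c"
  shows "(a \<oplus> b) \<curlywedge> c \<preceq> (a \<curlywedge> c) \<oplus> (b \<curlywedge> c)"
proof -
  let ?m = "(a \<oplus> b) \<curlywedge> c"
  \<comment> \<open>Covers the three terms with a summand \<open>c\<close>: the other summand is
    nonnegative, so each lies above \<open>c\<close>. The remaining term \<open>a \<oplus> b\<close>
    bounds \<open>?m\<close> directly.\<close>
  have le: "?m \<preceq> x \<oplus> c" if "x \<in> carrier A" "\<zero> \<preceq> x" for x
  proof -
    have "?m \<preceq> c" using a b c by (simp add: inf_le2)
    also have "c \<preceq> x \<oplus> c" using add_right_mono[of \<zero> x c] that c by simp
    finally show ?thesis using a b c that by simp
  qed
  have "?m \<preceq> a \<oplus> (b \<curlywedge> c)"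
    using a b c le[of a] by (simp add: add_inf_distrib le_infI inf_le1)
  moreover have "?m \<preceq> c \<oplus> (b \<curlywedge> c)"
    using a b c le[of b] le[of c] by (simp add: add_inf_distrib le_infI add_comm[of c b])
  moreover have "(a \<curlywedge> c) \<oplus> (b \<curlywedge> c) = (a \<oplus> (b \<curlywedge> c)) \<curlywedge> (c \<oplus> (b \<curlywedge> c))"
    using a b c add_inf_distrib[of "b \<curlywedge> c" a c] by (simp add: add_comm)
  ultimately show ?thesis
    using a b c by (simp add: le_infI)
qed

text \<open>The norm \<open>z \<star> \<zero>\<close> plays the role of the absolute value, so this
  is the analogue of the polar (orthogonal complement) in lattice-ordered groups.\<close>

definition polar :: "'a set \<Rightarrow> 'a set"
  where "polar S = {z \<in> carrier A. \<forall>s\<in>S. (z \<star> \<zero>) \<curlywedge> (s \<star> \<zero>) = \<zero>}"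

lemma inf_eq_zero_mono:
  assumes "a \<preceq> b" "b \<curlywedge> c = \<zero>" "\<zero> \<preceq> a" "\<zero> \<preceq> c"
    and "a \<in> carrier A" "b \<in> carrier A" "c \<in> carrier A"
  shows "a \<curlywedge> c = \<zero>"
proof (rule le_antisym)
  show "a \<curlywedge> c \<preceq> \<zero>"
    using inf_mono[of a b c c] assms by (simp add: le_refl)
  show "\<zero> \<preceq> a \<curlywedge> c"
    using assms by (simp add: le_infI)
qed (use assms in auto)

text \<open>Closure under addition combines \<open>norm_add_le\<close> with
  \<open>inf_add_le\<close>: if two norms are disjoint from that of \<open>s\<close>, so is their
  sum, and hence the norm of \<open>a \<oplus> b\<close> below it.\<close>

lemma al_ideal_polar:
  assumes S: "S \<subseteq> carrier A"
  shows "al_ideal A (polar S)"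
  unfolding al_ideal_def
proof (intro conjI ballI impI)
  have "(\<zero> \<star> \<zero>) \<curlywedge> (s \<star> \<zero>) = \<zero>" if "s \<in> S" for s
    using dist_nonneg[of s \<zero>] that S by (auto simp: al_le_def)
  hence "\<zero> \<in> polar S" by (auto simp: polar_def)
  thus "polar S \<noteq> {}" by auto
  show "polar S \<subseteq> carrier A" by (auto simp: polar_def)
next
  fix a b assume ab: "a \<in> polar S" "b \<in> polar S"
  have "((a \<oplus> b) \<star> \<zero>) \<curlywedge> (s \<star> \<zero>) = \<zero>" if "s \<in> S" for s
  proof -
    have cl: "a \<in> carrier A" "b \<in> carrier A" "s \<in> carrier A"
      using ab that S by (auto simp: polar_def)
    have z: "(a \<star> \<zero>) \<curlywedge> (s \<star> \<zero>) = \<zero>" "(b \<star> \<zero>) \<curlywedge> (s \<star> \<zero>) = \<zero>"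
      using ab that by (auto simp: polar_def)
    \<comment> \<open>The sum of the norms dominates the norm of \<open>a \<oplus> b\<close>, which
      is a distance and so nonnegative.\<close>
    have nn: "\<zero> \<preceq> (a \<star> \<zero>) \<oplus> (b \<star> \<zero>)"
      using dist_nonneg[of "a \<oplus> b" \<zero>] norm_add_le[of a b] cl le_trans
      by (meson add_closed dist_closed zero_closed)
    have "((a \<star> \<zero>) \<oplus> (b \<star> \<zero>)) \<curlywedge> (s \<star> \<zero>) \<preceq> \<zero>"
      using inf_add_le[of "a \<star> \<zero>" "b \<star> \<zero>" "s \<star> \<zero>"] z cl by (simp add: dist_nonneg)
    moreover have "\<zero> \<preceq> ((a \<star> \<zero>) \<oplus> (b \<star> \<zero>)) \<curlywedge> (s \<star> \<zero>)"
      using nn cl by (simp add: le_infI dist_nonneg)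
    ultimately have "((a \<star> \<zero>) \<oplus> (b \<star> \<zero>)) \<curlywedge> (s \<star> \<zero>) = \<zero>"
      using cl by (simp add: le_antisym)
    with norm_add_le[of a b] show ?thesis
      using cl by (meson inf_eq_zero_mono add_closed dist_closed dist_nonneg zero_closed)
  qed
  with ab show "a \<oplus> b \<in> polar S" by (auto simp: polar_def)
next
  fix a b assume a: "a \<in> polar S" and b: "b \<in> carrier A" and le: "b \<star> \<zero> \<preceq> a \<star> \<zero>"
  have "(b \<star> \<zero>) \<curlywedge> (s \<star> \<zero>) = \<zero>" if "s \<in> S" for s
  proof (rule inf_eq_zero_mono[OF le])
    show "(a \<star> \<zero>) \<curlywedge> (s \<star> \<zero>) = \<zero>" using a that by (auto simp: polar_def)
  qed (use a b that S in \<open>auto simp: polar_def dist_nonneg\<close>)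
  with b show "b \<in> polar S" by (auto simp: polar_def)
qed

text \<open>A common element is orthogonal to itself, so its norm vanishes and the metric separates
  it from nothing but \<open>\<zero>\<close>.\<close>

lemma inter_polar: "S \<inter> polar S \<subseteq> {\<zero>}"
proof
  fix z assume "z \<in> S \<inter> polar S"
  hence z: "z \<in> carrier A" "(z \<star> \<zero>) \<curlywedge> (z \<star> \<zero>) = \<zero>" by (auto simp: polar_def)
  thus "z \<in> {\<zero>}" by (simp add: dist_eq_zero_iff)
qed

text \<open>Orthogonality is a symmetric relation.\<close>

lemma subset_polar_polar:
  assumes "S \<subseteq> carrier A"
  shows "S \<subseteq> polar (polar S)"
proof
  fix s assume s: "s \<in> S"
  have "(s \<star> \<zero>) \<curlywedge> (z \<star> \<zero>) = \<zero>" if "z \<in> polar S" for z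
    using s that assms inf_comm[of "s \<star> \<zero>" "z \<star> \<zero>"] by (auto simp: polar_def)
  with s assms show "s \<in> polar (polar S)" unfolding polar_def[of "polar S"] by blast
qed

text \<open>Passes from primeness for ideals to primeness for elements: \<open>x\<close> lies in
  \<open>polar {y}\<close> by \<open>disj\<close> and \<open>y\<close> in the double polar, so
  primeness for this pair of ideals decides between them.\<close>

lemma prime_ideal_disjoint:
  assumes P: "al_prime_ideal A P" and x: "x \<in> carrier A" and y: "y \<in> carrier A"
    and disj: "(x \<star> \<zero>) \<curlywedge> (y \<star> \<zero>) = \<zero>" and zero: "\<zero> \<in> P"
  shows "x \<in> P \<or> y \<in> P"
proof -
  let ?I = "polar {y}"
  have I: "?I \<subseteq> carrier A" by (auto simp: polar_def)
  have "al_ideal A ?I" "al_ideal A (polar ?I)"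
    using y I by (auto intro: al_ideal_polar)
  moreover have "?I \<inter> polar ?I \<subseteq> P"
    using inter_polar[of ?I] zero by auto
  ultimately have "?I \<subseteq> P \<or> polar ?I \<subseteq> P"
    using P by (auto simp: al_prime_ideal_def)
  moreover have "x \<in> ?I" using x disj by (simp add: polar_def)
  moreover have "y \<in> polar ?I" using subset_polar_polar[of "{y}"] y by auto
  ultimately show ?thesis by auto
qed

text \<open>Once \<open>\<preceq>\<close> is unfolded to a meet equation, the contraction
  inequalities are universally quantified identities like the other laws, and identities pass to any
  subset closed under the operations.\<close>

lemma al_monoid_subalgebra:
  assumes S: "S \<subseteq> carrier A" "\<zero> \<in> S"
    and cl: "\<And>x y. \<lbrakk>x \<in> S; y \<in> S\<rbrakk> \<Longrightarrow>
      x \<oplus> y \<in> S \<and> x \<star> y \<in> S \<and> x \<curlyvee> y \<in> S \<and> x \<curlywedge> y \<in> S"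
  shows "al_monoid (A\<lparr>carrier := S\<rparr>)"
proof -
  have sub: "x \<in> carrier A" if "x \<in> S" for x using S that by auto
  have "comm_monoid \<lparr>carrier = S, mult = al_add A, one = \<zero>\<rparr>"
    by (rule comm_monoidI) (use S cl sub in \<open>auto simp: add_assoc intro: add_comm\<close>)
  with S cl sub show ?thesis
    by unfold_locales
      (auto simp: sup_assoc inf_assoc sup_inf_absorb inf_sup_absorb add_sup_distrib
        add_inf_distrib dist_inf_add dist_sup_disjoint al_contraction_def al_le_def[of "A\<lparr>carrier := S\<rparr>"]
        dist_add_le[unfolded al_le_def] dist_sup_le[unfolded al_le_def]
        dist_inf_le[unfolded al_le_def] dist_dist_le[unfolded al_le_def]
        add_assoc intro: sup_comm inf_comm add_comm)
qed

end

section \<open>Homomorphisms, their images and kernels\<close>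

locale al_monoid_hom = A: al_monoid A + B: al_monoid B
  for A :: "('a, 'm) al_algebra_scheme" and B :: "('b, 'n) al_algebra_scheme" +
  fixes \<alpha> :: "'a \<Rightarrow> 'b"
  assumes hom: "\<alpha> \<in> al_hom A B"
begin

lemma hom_closed [simp]: "x \<in> carrier A \<Longrightarrow> \<alpha> x \<in> carrier B"
  using hom by (auto simp: al_hom_def)

lemma hom_zero [simp]: "\<alpha> \<zero>\<^bsub>A\<^esub> = \<zero>\<^bsub>B\<^esub>"
  using hom by (auto simp: al_hom_def)

lemma hom_ops [simp]:
  assumes "x \<in> carrier A" "y \<in> carrier A"
  shows "\<alpha> (x \<oplus>\<^bsub>A\<^esub> y) = \<alpha> x \<oplus>\<^bsub>B\<^esub> \<alpha> y"
    and "\<alpha> (x \<star>\<^bsub>A\<^esub> y) = \<alpha> x \<star>\<^bsub>B\<^esub> \<alpha> y"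
    and "\<alpha> (x \<curlyvee>\<^bsub>A\<^esub> y) = \<alpha> x \<curlyvee>\<^bsub>B\<^esub> \<alpha> y"
    and "\<alpha> (x \<curlywedge>\<^bsub>A\<^esub> y) = \<alpha> x \<curlywedge>\<^bsub>B\<^esub> \<alpha> y"
  using hom assms by (auto simp: al_hom_def)

lemma hom_mono: "\<lbrakk>x \<preceq>\<^bsub>A\<^esub> y; x \<in> carrier A; y \<in> carrier A\<rbrakk> \<Longrightarrow> \<alpha> x \<preceq>\<^bsub>B\<^esub> \<alpha> y"
  by (metis al_le_def hom_ops(4))

lemma al_monoid_image: "al_monoid (al_image A B \<alpha>)"
  unfolding al_image_def
proof (rule B.al_monoid_subalgebra)
  show "\<zero>\<^bsub>B\<^esub> \<in> \<alpha> ` carrier A"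
    using hom_zero A.zero_closed by (metis imageI)
next
  fix x y assume "x \<in> \<alpha> ` carrier A" "y \<in> \<alpha> ` carrier A"
  then obtain a b where ab: "a \<in> carrier A" "b \<in> carrier A" and xy: "x = \<alpha> a" "y = \<alpha> b" by auto
  show "x \<oplus>\<^bsub>B\<^esub> y \<in> \<alpha> ` carrier A \<and> x \<star>\<^bsub>B\<^esub> y \<in> \<alpha> ` carrier A \<and>
      x \<curlyvee>\<^bsub>B\<^esub> y \<in> \<alpha> ` carrier A \<and> x \<curlywedge>\<^bsub>B\<^esub> y \<in> \<alpha> ` carrier A"
    unfolding xy hom_ops[OF ab, symmetric]
    using ab by (intro conjI imageI) simp_all
qed auto

text \<open>The image is always an AL-monoid and takes its meet, hence its order, from
  \<open>B\<close>; only totality remains to be expressed.\<close>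

lemma chain_image_iff:
  "chain_al_monoid (al_image A B \<alpha>) \<longleftrightarrow>
    (\<forall>a\<in>carrier A. \<forall>b\<in>carrier A. \<alpha> a \<preceq>\<^bsub>B\<^esub> \<alpha> b \<or> \<alpha> b \<preceq>\<^bsub>B\<^esub> \<alpha> a)"
  using al_monoid_image
  by (auto simp: chain_al_monoid_def chain_al_monoid_axioms_def al_image_def al_le_def)

lemma al_ideal_kernel: "al_ideal A (al_kernel A B \<alpha>)"
  unfolding al_ideal_def
proof (intro conjI ballI impI)
  have "\<zero>\<^bsub>A\<^esub> \<in> al_kernel A B \<alpha>" by (simp add: al_kernel_def)
  thus "al_kernel A B \<alpha> \<noteq> {}" by auto
next
  fix a b assume a: "a \<in> al_kernel A B \<alpha>" and b: "b \<in> carrier A"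
    and le: "b \<star>\<^bsub>A\<^esub> \<zero>\<^bsub>A\<^esub> \<preceq>\<^bsub>A\<^esub> a \<star>\<^bsub>A\<^esub> \<zero>\<^bsub>A\<^esub>"
  \<comment> \<open>Since \<open>\<alpha> a\<close> is zero, the norm of \<open>a\<close> is mapped
    to zero, and monotonicity of \<open>\<alpha>\<close> bounds the norm of
    \<open>\<alpha> b\<close> by it.\<close>
  have "\<alpha> b \<star>\<^bsub>B\<^esub> \<zero>\<^bsub>B\<^esub> \<preceq>\<^bsub>B\<^esub> \<zero>\<^bsub>B\<^esub>"
    using hom_mono[OF le] a b by (simp add: al_kernel_def)
  hence "\<alpha> b \<star>\<^bsub>B\<^esub> \<zero>\<^bsub>B\<^esub> = \<zero>\<^bsub>B\<^esub>"
    using b by (simp add: B.le_antisym B.dist_nonneg)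
  thus "b \<in> al_kernel A B \<alpha>"
    using b by (simp add: al_kernel_def B.dist_eq_zero_iff)
qed (auto simp: al_kernel_def)

section \<open>Prime kernels and totally ordered images\<close>

lemma chain_image_if_prime_kernel:
  assumes prime: "al_prime_ideal A (al_kernel A B \<alpha>)"
  shows "chain_al_monoid (al_image A B \<alpha>)"
  unfolding chain_image_iff
proof (intro ballI)
  fix a b assume ab: "a \<in> carrier A" "b \<in> carrier A"
  let ?x = "a \<star>\<^bsub>A\<^esub> (a \<curlyvee>\<^bsub>A\<^esub> b)" and ?y = "b \<star>\<^bsub>A\<^esub> (a \<curlyvee>\<^bsub>A\<^esub> b)"
  \<comment> \<open>\<open>?x\<close> and \<open>?y\<close> are distances, so they equal their own
    norms, and \<open>dist_sup_disjoint\<close> supplies exactly the disjointness required.\<close>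
  have "?x \<in> al_kernel A B \<alpha> \<or> ?y \<in> al_kernel A B \<alpha>"
    by (rule A.prime_ideal_disjoint[OF prime])
      (use ab in \<open>auto simp: A.dist_zero_of_nonneg A.dist_nonneg A.dist_sup_disjoint al_kernel_def\<close>)
  \<comment> \<open>The join is commuted in the second case, so that
    \<open>dist_sup_eq_zero_imp_le\<close> fits with the roles of \<open>a\<close> and
    \<open>b\<close> exchanged.\<close>
  hence "\<alpha> a \<star>\<^bsub>B\<^esub> (\<alpha> a \<curlyvee>\<^bsub>B\<^esub> \<alpha> b) = \<zero>\<^bsub>B\<^esub> \<or> \<alpha> b \<star>\<^bsub>B\<^esub> (\<alpha> b \<curlyvee>\<^bsub>B\<^esub> \<alpha> a) = \<zero>\<^bsub>B\<^esub>"
    using ab B.sup_comm[of "\<alpha> a" "\<alpha> b"] by (auto simp: al_kernel_def)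
  thus "\<alpha> a \<preceq>\<^bsub>B\<^esub> \<alpha> b \<or> \<alpha> b \<preceq>\<^bsub>B\<^esub> \<alpha> a"
    using ab B.dist_sup_eq_zero_imp_le[of "\<alpha> a" "\<alpha> b"] B.dist_sup_eq_zero_imp_le[of "\<alpha> b" "\<alpha> a"]
    by auto
qed

lemma prime_kernel_if_chain_image:
  assumes chain: "chain_al_monoid (al_image A B \<alpha>)"
  shows "al_prime_ideal A (al_kernel A B \<alpha>)"
  unfolding al_prime_ideal_def
proof (intro conjI allI impI al_ideal_kernel)
  fix I J assume I: "al_ideal A I" and J: "al_ideal A J" and IJ: "I \<inter> J \<subseteq> al_kernel A B \<alpha>"
  show "I \<subseteq> al_kernel A B \<alpha> \<or> J \<subseteq> al_kernel A B \<alpha>"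
  proof (rule ccontr)
    assume "\<not> ?thesis"
    then obtain a b where a: "a \<in> I" "a \<notin> al_kernel A B \<alpha>"
      and b: "b \<in> J" "b \<notin> al_kernel A B \<alpha>" by auto
    have cl: "a \<in> carrier A" "b \<in> carrier A"
      using a b I J by (auto simp: al_ideal_def)
    let ?m = "(a \<star>\<^bsub>A\<^esub> \<zero>\<^bsub>A\<^esub>) \<curlywedge>\<^bsub>A\<^esub> (b \<star>\<^bsub>A\<^esub> \<zero>\<^bsub>A\<^esub>)"
    \<comment> \<open>As a meet of nonnegative elements \<open>?m\<close> is its own norm; thus the
      norm of \<open>?m\<close> is below those of \<open>a\<close> and \<open>b\<close>, which puts
      \<open>?m\<close> into both ideals.\<close>
    have "?m \<star>\<^bsub>A\<^esub> \<zero>\<^bsub>A\<^esub> = ?m"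
      using cl by (simp add: A.dist_zero_of_nonneg A.le_infI A.dist_nonneg)
    hence "?m \<star>\<^bsub>A\<^esub> \<zero>\<^bsub>A\<^esub> \<preceq>\<^bsub>A\<^esub> a \<star>\<^bsub>A\<^esub> \<zero>\<^bsub>A\<^esub>" "?m \<star>\<^bsub>A\<^esub> \<zero>\<^bsub>A\<^esub> \<preceq>\<^bsub>A\<^esub> b \<star>\<^bsub>A\<^esub> \<zero>\<^bsub>A\<^esub>" "?m \<in> carrier A"
      using cl by (simp_all add: A.inf_le1 A.inf_le2)
    hence "?m \<in> I" "?m \<in> J"
      using I J a(1) b(1) unfolding al_ideal_def by blast+
    hence "\<alpha> ?m = \<zero>\<^bsub>B\<^esub>"
      using IJ by (auto simp: al_kernel_def)
    hence inf_zero: "(\<alpha> a \<star>\<^bsub>B\<^esub> \<zero>\<^bsub>B\<^esub>) \<curlywedge>\<^bsub>B\<^esub> (\<alpha> b \<star>\<^bsub>B\<^esub> \<zero>\<^bsub>B\<^esub>) = \<zero>\<^bsub>B\<^esub>"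
      using cl by simp
    \<comment> \<open>Totality is applied to the images of the norms: their meet is then one of the
      two, so one norm is zero, and by \<open>dist_eq_zero_iff\<close> its element would be in the
      kernel.\<close>
    have "\<alpha> (a \<star>\<^bsub>A\<^esub> \<zero>\<^bsub>A\<^esub>) \<preceq>\<^bsub>B\<^esub> \<alpha> (b \<star>\<^bsub>A\<^esub> \<zero>\<^bsub>A\<^esub>) \<or> \<alpha> (b \<star>\<^bsub>A\<^esub> \<zero>\<^bsub>A\<^esub>) \<preceq>\<^bsub>B\<^esub> \<alpha> (a \<star>\<^bsub>A\<^esub> \<zero>\<^bsub>A\<^esub>)"
      using chain cl unfolding chain_image_iff by (meson A.dist_closed A.zero_closed)
    hence "\<alpha> a \<star>\<^bsub>B\<^esub> \<zero>\<^bsub>B\<^esub> = \<zero>\<^bsub>B\<^esub> \<or> \<alpha> b \<star>\<^bsub>B\<^esub> \<zero>\<^bsub>B\<^esub> = \<zero>\<^bsub>B\<^esub>"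
      using cl inf_zero B.inf_comm[of "\<alpha> a \<star>\<^bsub>B\<^esub> \<zero>\<^bsub>B\<^esub>" "\<alpha> b \<star>\<^bsub>B\<^esub> \<zero>\<^bsub>B\<^esub>"] by (auto simp: al_le_def)
    with a(2) b(2) cl show False
      by (auto simp: al_kernel_def B.dist_eq_zero_iff)
  qed
qed

end

theorem theorem5p9:
  fixes A :: "'a al_algebra" and B :: "'b al_algebra" and \<alpha> :: "'a \<Rightarrow> 'b"
  assumes "al_monoid A" and "al_monoid B" and "\<alpha> \<in> al_hom A B"
  shows "al_prime_ideal A (al_kernel A B \<alpha>) \<longleftrightarrow> chain_al_monoid (al_image A B \<alpha>)"
proof -
  interpret al_monoid_hom A B \<alpha>
    using assms by (simp add: al_monoid_hom_def al_monoid_hom_axioms_def)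
  show ?thesis
    using chain_image_if_prime_kernel prime_kernel_if_chain_image by blast
qed

end
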